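(* In the Discriminative Feature Feedback protocol described in the context, suppose that the input stream is consistent with some representation of size $m$ with at most $k$ exceptions, and suppose further that each component of that representation has a unique label (no two components share a label). Then there exists a (randomized) algorithm whose expected number of mistakes is at most $2m(m-1)+6k$.
   Context: Setting. Let $\mathcal{X}$ be a domain of examples, $\mathcal{Y}$ a finite set of labels, and $\Phi$ a (possibly infinite) set of binary features $\phi:\mathcal{X}\to\{\texttt{true},\texttt{false}\}$, closed under negation. A representation of size $m$ is a family $\mathcal{G}=\{G_1,\dots,G_m\}$ of subsets (components) of $\mathcal{X}$ with $\mathcal{X}=\bigcup_i G_i$; each component $G$ has a label $\ell(G)\in\mathcal{Y}$; for each $x$ a fixed component $G(x)\ni x$ is chosen, and the target concept is $c^*(x)=\ell(G(x))$. For any two components $G_i,G_j$ with $\ell(G_i)\neq\ell(G_j)$ there is a discriminative feature $\phi(G_i,G_j)\in\Phi$ true on every $x\in G_i$ and false on every $x\in G_j$, with $\phi(G_j,G_i)=\neg\phi(G_i,G_j)$. Protocol. The learner first receives an example $x_0$ with its label $y_0$. Then in each round: an example $x_t$ arrives; the learner predicts a label $\hat y_t$ together with an explanation $\hat x_t$, an example previously observed with label $\hat y_t$; if the prediction is correct no feedback is given; if it is incorrect (a mistake), the teacher provides $y_t=c^*(x_t)$ and the feature $\phi(G(x_t),G(\hat x_t))$. An example is an exception if the teacher's feedback on it is inconsistent with the representation and the protocol. The stream is consistent with a representation of size $m$ with at most $k$ exceptions if some such representation exists for which all feedback conforms to the protocol except on at most $k$ examples; the stream is otherwise arbitrary. 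*)

theory Defs
  imports "HOL-Probability.Probability"
begin

text \<open>A round of the protocol: (example x_t, predicted label, explanation,
  feedback). Feedback is None if the prediction was correct, otherwise
  Some (true label, discriminative feature).\<close>
type_synonym ('x, 'y) rnd = "'x \<times> 'y \<times> 'x \<times> ('y \<times> ('x \<Rightarrow> bool)) option"

text \<open>A (randomized) learner: given x_0, y_0, the history of past rounds and the
  current example, it outputs a distribution over (predicted label, explanation).\<close>
type_synonym ('x, 'y) learner = "'x \<Rightarrow> 'y \<Rightarrow> ('x, 'y) rnd list \<Rightarrow> 'x \<Rightarrow> ('y \<times> 'x) pmf"

definition observed :: "'x \<Rightarrow> 'y \<Rightarrow> ('x, 'y) rnd list \<Rightarrow> ('x \<times> 'y) set" where
  "observed x0 y0 h = insert (x0, y0)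
     ((\<lambda>(x, yh, xh, fb). (x, case fb of None \<Rightarrow> yh | Some (y, _) \<Rightarrow> y)) ` set h)"

definition valid_learner :: "('x, 'y) learner \<Rightarrow> bool" where
  "valid_learner L \<longleftrightarrow>
     (\<forall>x0 y0 h x. \<forall>(yh, xh) \<in> set_pmf (L x0 y0 h x). (xh, yh) \<in> observed x0 y0 h)"

definition play_round :: "nat \<Rightarrow> 'x \<Rightarrow> 'y \<Rightarrow> (nat \<Rightarrow> 'y \<Rightarrow> 'x \<Rightarrow> ('x \<Rightarrow> bool))
    \<Rightarrow> 'y \<times> 'x \<Rightarrow> ('x, 'y) rnd" where
  "play_round t x y feat p =
     (case p of (yh, xh) \<Rightarrow> (x, yh, xh, if yh = y then None else Some (y, feat t yh xh)))"

primrec dff_run :: "('x, 'y) learner \<Rightarrow> (nat \<Rightarrow> 'x) \<Rightarrow> (nat \<Rightarrow> 'y)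
    \<Rightarrow> (nat \<Rightarrow> 'y \<Rightarrow> 'x \<Rightarrow> ('x \<Rightarrow> bool)) \<Rightarrow> nat \<Rightarrow> ('x, 'y) rnd list pmf" where
  "dff_run L xs ys feat 0 = return_pmf []"
| "dff_run L xs ys feat (Suc n) =
     bind_pmf (dff_run L xs ys feat n)
       (\<lambda>h. map_pmf
              (\<lambda>p. h @ [play_round (Suc (length h)) (xs (Suc (length h))) (ys (Suc (length h))) feat p])
              (L (xs 0) (ys 0) h (xs (Suc (length h)))))"

definition mistakes :: "('x, 'y) rnd list \<Rightarrow> nat" where
  "mistakes h = length (filter (\<lambda>(_, _, _, fb). fb \<noteq> None) h)"

definition dff_representation ::
  "('x \<Rightarrow> bool) set \<Rightarrow> nat \<Rightarrow> (nat \<Rightarrow> 'x set) \<Rightarrow> (nat \<Rightarrow> 'y) \<Rightarrow> ('x \<Rightarrow> nat)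
     \<Rightarrow> (nat \<Rightarrow> nat \<Rightarrow> ('x \<Rightarrow> bool)) \<Rightarrow> bool" where
  "dff_representation Phi m Gc lab gx phi \<longleftrightarrow>
     (\<Union>i<m. Gc i) = UNIV \<and>
     (\<forall>x. gx x < m \<and> x \<in> Gc (gx x)) \<and>
     (\<forall>i<m. \<forall>j<m. lab i \<noteq> lab j \<longrightarrow>
        phi i j \<in> Phi \<and> (\<forall>x\<in>Gc i. phi i j x) \<and> (\<forall>x\<in>Gc j. \<not> phi i j x) \<and>
        phi j i = (\<lambda>x. \<not> phi i j x))"

end

theory Submission
  imports Defs
begin

text \<open>
  With unique labels, a state of knowledge is a family of pairwise comparisons between labels, so on
  each example the labels form a tournament. The symmetric zero-sum game of that tournament has value
  zero, and its optimal mixed strategy has the property that, whatever the true label \<open>y\<close> is, at least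
  half of the probability of a mistake falls on labels \<open>z\<close> that \<open>y\<close> is not known to beat. Such a mistake
  is informative: if the explanation used for \<open>z\<close> is genuine, it settles the pair \<open>y, z\<close> until an exception
  unsettles it. To limit the harm of explanations that stem from exceptions, every explanation is discarded
  after its first informative mistake, and a label without explanation takes the next example on which
  it is revealed by a mistake. The potential \<open>3 p + 2 b + g\<close>, for \<open>p\<close> unsettled pairs, \<open>b\<close> bad explanations and \<open>g\<close> labels
  without a good explanation, then bounds the expected number of future mistakes, up to the exceptions.
\<close>

section \<open>Optimal play in symmetric zero-sum games and tournaments\<close>

text \<open>As in Nash's proof, Brouwer's theorem is applied to the map that shifts weight to profitable pure strategies.\<close>

lemma skew_symmetric_game:
  fixes M :: "'a::finite \<Rightarrow> 'a \<Rightarrow> real"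
  assumes skew: "\<And>i j. M i j = - M j i" and "A \<noteq> {}"
  obtains p :: "'a \<Rightarrow> real" where "\<And>i. 0 \<le> p i" "(\<Sum>i\<in>UNIV. p i) = 1"
    "\<And>i. i \<notin> A \<Longrightarrow> p i = 0" "\<And>i. i \<in> A \<Longrightarrow> (\<Sum>j\<in>UNIV. M i j * p j) \<le> 0"
proof -
  define S :: "(real ^ 'a) set"
    where "S = {p. (\<forall>i. 0 \<le> p $ i) \<and> (\<Sum>i\<in>UNIV. p $ i) = 1 \<and> (\<forall>i. i \<notin> A \<longrightarrow> p $ i = 0)}"
  \<comment> \<open>By skew symmetry \<open>p\<close> earns zero against itself, so the profit from
    switching to \<open>i\<close> is the positive part of the payoff of \<open>i\<close> against
    \<open>p\<close>.\<close>
  define g :: "'a \<Rightarrow> real ^ 'a \<Rightarrow> real"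
    where "g = (\<lambda>i p. of_bool (i \<in> A) * max 0 (\<Sum>j\<in>UNIV. M i j * p $ j))"
  define f :: "real ^ 'a \<Rightarrow> real ^ 'a"
    where "f = (\<lambda>p. \<chi> i. (p $ i + g i p) / (1 + (\<Sum>j\<in>UNIV. g j p)))"
  have g_nonneg: "0 \<le> g i p" for i p
    by (simp add: g_def)
  have sum_g_nonneg: "0 \<le> (\<Sum>j\<in>UNIV. g j p)" for p
    by (simp add: sum_nonneg g_nonneg)
  have S_eq: "S = (\<Inter>i. {p. 0 \<le> p $ i}) \<inter> {p. (\<Sum>i\<in>UNIV. p $ i) = 1} \<inter> (\<Inter>i\<in>-A. {p. p $ i = 0})"
    by (auto simp: S_def)
  have "closed S"
    unfolding S_eq by (intro closed_Int closed_INT ballI closed_Collect_le closed_Collect_eq continuous_intros)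
  moreover have "bounded S"
  proof -
    have "norm p \<le> 1" if "p \<in> S" for p
      using norm_le_l1_cart[of p] that by (simp add: S_def)
    then show ?thesis by (auto simp: bounded_iff)
  qed
  ultimately have "compact S" by (simp add: compact_eq_bounded_closed)
  moreover have "convex S"
    unfolding convex_def S_def
    by (auto simp: sum.distrib sum_distrib_left[symmetric])
  moreover obtain a where "a \<in> A" using \<open>A \<noteq> {}\<close> by blast
  then have "axis a 1 \<in> S"
    by (auto simp: S_def axis_def)
  then have "S \<noteq> {}" by blast
  moreover have "continuous_on S f"
  proof -
    have "1 + (\<Sum>j\<in>UNIV. g j p) \<noteq> 0" for p using sum_g_nonneg[of p] by simp
    moreover have "continuous_on S (g i)" for i
      unfolding g_def by (intro continuous_intros)
    ultimately show ?thesis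
      unfolding f_def by (intro continuous_intros) auto
  qed
  moreover have "f \<in> S \<rightarrow> S"
  proof
    fix p assume "p \<in> S"
    moreover have "(\<Sum>i\<in>UNIV. (p $ i + g i p) / (1 + (\<Sum>j\<in>UNIV. g j p))) = 1" if "(\<Sum>i\<in>UNIV. p $ i) = 1"
      using that sum_g_nonneg[of p] by (simp add: sum_divide_distrib[symmetric] sum.distrib)
    ultimately show "f p \<in> S"
      using sum_g_nonneg[of p] g_nonneg by (auto simp: S_def f_def g_def)
  qed
  ultimately obtain p where p: "p \<in> S" "f p = p"
    by (rule brouwer)
  define s where "s = (\<Sum>j\<in>UNIV. g j p)"
  have s: "0 \<le> s" using sum_g_nonneg s_def by simp
  have fix_eq: "g i p = s * p $ i" for i
  proof -
    have "(p $ i + g i p) / (1 + s) = p $ i"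
      using p(2) by (simp add: f_def vec_eq_iff s_def)
    then show ?thesis using s by (simp add: field_simps)
  qed
  \<comment> \<open>If \<open>s\<close> were positive, every \<open>i\<close> in the support of
    \<open>p\<close> would have payoff \<open>s * p $ i\<close> by \<open>fix_eq\<close>. Averaging
    over \<open>p\<close> gives \<open>s\<close> times a sum of squares, but skew symmetry makes
    this average zero.\<close>
  have "s = 0"
  proof (rule ccontr)
    assume "s \<noteq> 0"
    let ?q = "\<Sum>i\<in>UNIV. \<Sum>j\<in>UNIV. p $ i * (M i j * p $ j)"
    have "?q = (\<Sum>i\<in>UNIV. \<Sum>j\<in>UNIV. - (p $ j * (M j i * p $ i)))"
      by (intro sum.cong refl) (subst skew, simp)
    also have "\<dots> = - ?q"
      by (subst sum.swap) (simp add: sum_negf)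
    finally have "?q = 0" by simp
    moreover have "(\<Sum>j\<in>UNIV. p $ i * (M i j * p $ j)) = s * (p $ i)\<^sup>2" for i
    proof (cases "p $ i = 0")
      case False
      then have "0 < g i p" using fix_eq[of i] s \<open>s \<noteq> 0\<close> p(1) by (auto simp: S_def less_le)
      then have "g i p = (\<Sum>j\<in>UNIV. M i j * p $ j)"
        by (auto simp: g_def max_def split: if_splits)
      then show ?thesis
        using fix_eq[of i] by (simp add: sum_distrib_left[symmetric] power2_eq_square)
    qed simp
    ultimately have "s * (\<Sum>i\<in>UNIV. (p $ i)\<^sup>2) = 0"
      by (simp add: sum_distrib_left)
    with \<open>s \<noteq> 0\<close> have "\<forall>i. p $ i = 0"
      by (simp add: sum_nonneg_eq_0_iff)
    then show False using p(1) by (simp add: S_def)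
  qed
  have "(\<Sum>j\<in>UNIV. M i j * p $ j) \<le> 0" if "i \<in> A" for i
    using fix_eq[of i] that \<open>s = 0\<close> by (auto simp: g_def max_def split: if_splits)
  with p(1) show thesis
    by (intro that[of "\<lambda>i. p $ i"]) (auto simp: S_def)
qed

text \<open>Against optimal play no \<open>y\<close> in \<open>A\<close> profits on average, so its
  strict wins carry at most the weight of its strict losses. Ties are put on the side of the
  losses.\<close>

lemma tournament_strategy:
  fixes R :: "'a::finite \<Rightarrow> 'a \<Rightarrow> bool"
  assumes "A \<noteq> {}"
  shows "\<exists>p. set_pmf p \<subseteq> A \<and> (\<forall>y\<in>A. measure_pmf.prob p {z. z \<noteq> y}
           \<le> 2 * measure_pmf.prob p {z. z \<noteq> y \<and> (R y z \<longrightarrow> R z y)})"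
proof -
  define M :: "'a \<Rightarrow> 'a \<Rightarrow> real" where "M = (\<lambda>i j. of_bool (R i j) - of_bool (R j i))"
  obtain q where q: "\<And>i. 0 \<le> q i" "(\<Sum>i\<in>UNIV. q i) = 1" "\<And>i. i \<notin> A \<Longrightarrow> q i = 0"
    and q_opt: "\<And>i. i \<in> A \<Longrightarrow> (\<Sum>j\<in>UNIV. M i j * q j) \<le> 0"
    by (rule skew_symmetric_game[of M A]) (use assms in \<open>auto simp: M_def\<close>)
  define p where "p = embed_pmf q"
  have pmf_p: "pmf p i = q i" for i
    unfolding p_def
    by (rule pmf_embed_pmf) (simp_all add: q nn_integral_count_space_finite)
  have prob_p: "measure_pmf.prob p X = (\<Sum>i\<in>UNIV. of_bool (i \<in> X) * q i)" for X
    by (simp add: measure_measure_pmf_finite pmf_p sum.If_cases of_bool_def if_distrib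
        if_distribR cong: if_cong)
  have "measure_pmf.prob p {z. z \<noteq> y} \<le> 2 * measure_pmf.prob p {z. z \<noteq> y \<and> (R y z \<longrightarrow> R z y)}"
    if "y \<in> A" for y
  proof -
    \<comment> \<open>For \<open>z\<close> other than \<open>y\<close>, the coefficient 1 is at most
      1 + 0 on a strict win, 0 + 2 on a tie and -1 + 2 on a strict loss.\<close>
    have "measure_pmf.prob p {z. z \<noteq> y}
        \<le> (\<Sum>z\<in>UNIV. M y z * q z + 2 * (of_bool (z \<in> {z. z \<noteq> y \<and> (R y z \<longrightarrow> R z y)}) * q z))"
      unfolding prob_p using q(1) by (intro sum_mono) (auto simp: M_def of_bool_def)
    also have "\<dots> \<le> 2 * measure_pmf.prob p {z. z \<noteq> y \<and> (R y z \<longrightarrow> R z y)}"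
      unfolding prob_p using q_opt[OF that] by (simp only: sum.distrib sum_distrib_left[symmetric])
    finally show ?thesis .
  qed
  moreover have "set_pmf p \<subseteq> A"
    using q(3) by (auto simp: set_pmf_eq pmf_p)
  ultimately show ?thesis by blast
qed

section \<open>The learner and the validity of its explanations\<close>

text \<open>A state \<open>(S, W)\<close> holds at most one explanation \<open>S y\<close> per label \<open>y\<close>, and \<open>W u v x\<close> says that the
  latest feature learned for the labels \<open>u\<close> and \<open>v\<close> favours \<open>u\<close> over \<open>v\<close> on \<open>x\<close>. A wrong prediction \<open>z\<close>
  changes the state of a pair only if the stored feature did not already favour the true label;
  the game strategy bounds the remaining mistakes.\<close>

type_synonym ('x, 'y) state = "('y \<rightharpoonup> 'x) \<times> ('y \<Rightarrow> 'y \<Rightarrow> 'x \<Rightarrow> bool)"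

text \<open>The two ordered entries receive complementary values, so a learned pair of distinct
  labels has no ties, whereas the initial constant \<open>False\<close> is a tie everywhere.\<close>

definition orient :: "('y \<Rightarrow> 'y \<Rightarrow> 'x \<Rightarrow> bool) \<Rightarrow> 'y \<Rightarrow> 'y \<Rightarrow> ('x \<Rightarrow> bool) \<Rightarrow> 'y \<Rightarrow> 'y \<Rightarrow> 'x \<Rightarrow> bool" where
  "orient W y z f = (\<lambda>u v. if u = y \<and> v = z then f else if u = z \<and> v = y then (\<lambda>x. \<not> f x) else W u v)"

fun update :: "('x, 'y) state \<Rightarrow> ('x, 'y) rnd \<Rightarrow> ('x, 'y) state" where
  "update (S, W) (x, z, x', None) = (S, W)"
| "update (S, W) (x, z, x', Some (y, f)) =
     (if S y = None then (S(y \<mapsto> x), W)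
      else if S z \<noteq> None \<and> (W y z x \<longrightarrow> W z y x)
        then (S(z := None), orient W y z f)
      else (S, W))"

definition state_of :: "'x \<Rightarrow> 'y \<Rightarrow> ('x, 'y) rnd list \<Rightarrow> ('x, 'y) state" where
  "state_of x0 y0 h = foldl update ([y0 \<mapsto> x0], \<lambda>_ _ _. False) h"

definition strategy :: "'y::finite set \<Rightarrow> ('y \<Rightarrow> 'y \<Rightarrow> bool) \<Rightarrow> 'y pmf" where
  "strategy A R = (SOME p. set_pmf p \<subseteq> A \<and> (\<forall>y\<in>A. measure_pmf.prob p {z. z \<noteq> y}
     \<le> 2 * measure_pmf.prob p {z. z \<noteq> y \<and> (R y z \<longrightarrow> R z y)}))"

text \<open>The default \<open>(y0, x0)\<close> is observed under every history, which keeps the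
  learner valid on arbitrary histories.\<close>

definition learner :: "('x, 'y::finite) learner" where
  "learner x0 y0 h x = (case state_of x0 y0 h of (S, W) \<Rightarrow>
     if dom S = {} then return_pmf (y0, x0)
     else map_pmf (\<lambda>z. (z, the (S z))) (strategy (dom S) (\<lambda>u v. W u v x)))"

lemma
  assumes "A \<noteq> {}"
  shows set_pmf_strategy: "set_pmf (strategy A R) \<subseteq> A"
    and strategy_bound: "y \<in> A \<Longrightarrow> measure_pmf.prob (strategy A R) {z. z \<noteq> y}
           \<le> 2 * measure_pmf.prob (strategy A R) {z. z \<noteq> y \<and> (R y z \<longrightarrow> R z y)}"
  using someI_ex[OF tournament_strategy[OF assms, of R]] unfolding strategy_def[symmetric] by auto

lemma state_of_append: "state_of x0 y0 (h @ [r]) = update (state_of x0 y0 h) r"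
  by (simp add: state_of_def)

text \<open>An example is stored for a label only in the round whose feedback reveals that label;
  all other updates keep or delete explanations.\<close>

lemma explanation_observed:
  assumes "fst (state_of x0 y0 h) z = Some x"
  shows "(x, z) \<in> observed x0 y0 h"
  using assms
proof (induction h rule: rev_induct)
  case Nil
  then show ?case by (auto simp: state_of_def observed_def split: if_splits)
next
  case (snoc r h)
  obtain S W where s: "state_of x0 y0 h = (S, W)" by fastforce
  obtain x1 z1 x1' fb where r: "r = (x1, z1, x1', fb)" by (metis prod_cases4)
  have mono: "observed x0 y0 h \<subseteq> observed x0 y0 (h @ [r])"
    unfolding observed_def by (intro Set.insert_mono image_mono) auto
  show ?case
  proof (cases "S z = Some x")
    case True
    then show ?thesis using snoc.IH s mono by auto
  next
    case False
    then show ?thesis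
      using snoc.prems s r
      by (cases fb) (auto simp: state_of_append observed_def split: if_splits)
  qed
qed

lemma valid_learner: "valid_learner learner"
  unfolding valid_learner_def
proof (intro allI, clarify)
  fix x0 :: 'a and y0 :: 'b and h x z x'
  assume z: "(z, x') \<in> set_pmf (learner x0 y0 h x)"
  obtain S W where s: "state_of x0 y0 h = (S, W)" by fastforce
  show "(x', z) \<in> observed x0 y0 h"
  proof (cases "dom S = {}")
    case True
    then show ?thesis using z s by (simp add: learner_def observed_def)
  next
    case False
    then have "z \<in> dom S" "x' = the (S z)"
      using z s set_pmf_strategy[OF False] by (auto simp: learner_def)
    then show ?thesis
      using explanation_observed[of x0 y0 h z x'] s by auto
  qed
qed

lemma finite_set_pmf_learner: "finite (set_pmf (learner x0 y0 h x))"
  by (auto simp: learner_def split: prod.split intro: finite_subset[OF subset_UNIV])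

section \<open>The potential and its change in one round\<close>

text \<open>Correctness is asked only on examples of the two labels: elsewhere the pair may point
  either way, as only pairs with the true label enter the analysis of a mistake.\<close>

definition settled :: "('x \<Rightarrow> 'y) \<Rightarrow> ('y \<Rightarrow> 'y \<Rightarrow> 'x \<Rightarrow> bool) \<Rightarrow> 'y \<Rightarrow> 'y \<Rightarrow> bool" where
  "settled c W u v \<longleftrightarrow>
     (\<forall>x. (c x = u \<longrightarrow> W u v x \<and> \<not> W v u x) \<and> (c x = v \<longrightarrow> W v u x \<and> \<not> W u v x))"

definition unsettled :: "('x \<Rightarrow> 'y) \<Rightarrow> ('y \<Rightarrow> 'y \<Rightarrow> 'x \<Rightarrow> bool) \<Rightarrow> ('y \<times> 'y) set" where
  "unsettled c W = {(u, v). u \<in> range c \<and> v \<in> range c \<and> u \<noteq> v \<and> \<not> settled c W u v}"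

definition misleading :: "('x \<Rightarrow> 'y) \<Rightarrow> ('y \<rightharpoonup> 'x) \<Rightarrow> 'y set" where
  "misleading c S = {u. \<exists>x. S u = Some x \<and> c x \<noteq> u}"

text \<open>A label of \<open>range c\<close> with a misleading explanation counts here too, so
  discarding that explanation leaves this set unchanged.\<close>

definition missing :: "('x \<Rightarrow> 'y) \<Rightarrow> ('y \<rightharpoonup> 'x) \<Rightarrow> 'y set" where
  "missing c S = {u \<in> range c. \<nexists>x. S u = Some x \<and> c x = u}"

text \<open>The weights make an exception cost at most 5 in total, its own mistake included: either it
  installs one misleading explanation (2), or it unsettles one pair of labels, which is counted twice
  as an ordered pair (3), and removes one good explanation (1).\<close>

fun potential :: "('x \<Rightarrow> 'y) \<Rightarrow> ('x, 'y) state \<Rightarrow> real" where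
  "potential c (S, W) = 3 / 2 * card (unsettled c W) + 2 * card (misleading c S) + card (missing c S)"

lemma potential_nonneg: "0 \<le> potential c s"
  by (cases s) simp

lemma settled_commute: "settled c W u v \<longleftrightarrow> settled c W v u"
  by (auto simp: settled_def)

lemma settled_orient_other:
  assumes "(u, v) \<noteq> (y, z)" "(u, v) \<noteq> (z, y)"
  shows "settled c (orient W y z f) u v \<longleftrightarrow> settled c W u v"
proof -
  have "\<not> (u = y \<and> v = z)" "\<not> (u = z \<and> v = y)" "\<not> (v = y \<and> u = z)" "\<not> (v = z \<and> u = y)"
    using assms by blast+
  then have "orient W y z f u v = W u v" "orient W y z f v u = W v u"
    by (simp_all only: orient_def if_False)
  then show ?thesis by (simp only: settled_def)
qed

lemma settled_orient:
  assumes "y \<noteq> z" "\<And>a. (c a = y \<longrightarrow> f a) \<and> (c a = z \<longrightarrow> \<not> f a)"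
  shows "settled c (orient W y z f) y z"
proof -
  have "orient W y z f y z = f" "orient W y z f z y = (\<lambda>x. \<not> f x)"
    using assms(1) by (auto simp: orient_def)
  then show ?thesis using assms(2) by (simp add: settled_def)
qed

lemma unsettled_orient: "unsettled c (orient W y z f) \<subseteq> unsettled c W \<union> {(y, z), (z, y)}"
proof (rule subrelI)
  fix u v assume "(u, v) \<in> unsettled c (orient W y z f)"
  then show "(u, v) \<in> unsettled c W \<union> {(y, z), (z, y)}"
    using settled_orient_other[of u v y z c W f] by (auto simp: unsettled_def)
qed

lemma card_le_Suc_of_subset_insert:
  assumes "finite A" "B \<subseteq> insert u A"
  shows "card B \<le> card A + 1"
  using card_mono[of "insert u A" B] assms by (simp add: card_insert_if split: if_splits)

text \<open>Label and feature are arbitrary, as in an exception. An installation adds at most 2,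
  since no label becomes missing; a reorientation adds at most 3 for two ordered pairs and 1 for the
  discarded explanation.\<close>

lemma potential_update_le:
  fixes c :: "'x \<Rightarrow> 'y::finite"
  shows "potential c (update s (play_round t x y feat (z, x'))) \<le> potential c s + 4"
proof -
  obtain S W where s: "s = (S, W)" by fastforce
  consider "z = y" | "z \<noteq> y" "S y = None" | "z \<noteq> y" "S y \<noteq> None" "S z \<noteq> None" "W y z x \<longrightarrow> W z y x"
    | "z \<noteq> y" "S y \<noteq> None" "\<not> (S z \<noteq> None \<and> (W y z x \<longrightarrow> W z y x))"
    by blast
  then show ?thesis
  proof cases
    case 2
    have "misleading c (S(y \<mapsto> x)) \<subseteq> insert y (misleading c S)"
      by (auto simp: misleading_def split: if_splits)
    then have "card (misleading c (S(y \<mapsto> x))) \<le> card (misleading c S) + 1"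
      by (intro card_le_Suc_of_subset_insert) auto
    moreover have "missing c (S(y \<mapsto> x)) \<subseteq> missing c S"
      using 2 by (auto simp: missing_def split: if_splits)
    then have "card (missing c (S(y \<mapsto> x))) \<le> card (missing c S)"
      by (simp add: card_mono)
    ultimately show ?thesis using 2 s by (simp add: play_round_def)
  next
    case 3
    let ?W = "orient W y z (feat t z x')"
    have "unsettled c ?W \<subseteq> unsettled c W \<union> {(y, z), (z, y)}"
      by (rule unsettled_orient)
    then have "card (unsettled c ?W) \<le> card (unsettled c W) + card {(y, z), (z, y)}"
      by (rule order.trans[OF card_mono card_Un_le, rotated]) simp
    moreover have "card {(y, z), (z, y)} = 2"
      using 3 by auto
    moreover have "card (misleading c (S(z := None))) \<le> card (misleading c S)"
      by (rule card_mono) (auto simp: misleading_def split: if_splits)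
    moreover have "missing c (S(z := None)) \<subseteq> insert z (missing c S)"
      by (auto simp: missing_def split: if_splits)
    then have "card (missing c (S(z := None))) \<le> card (missing c S) + 1"
      by (intro card_le_Suc_of_subset_insert) auto
    ultimately show ?thesis using 3 s by (auto simp: play_round_def)
  qed (use s in \<open>auto simp: play_round_def\<close>)
qed

lemma potential_update_new_label:
  fixes c :: "'x \<Rightarrow> 'y::finite"
  assumes "S (c x) = None"
  shows "of_bool (z \<noteq> c x) + potential c (update (S, W) (play_round t x (c x) feat (z, x'))) \<le> potential c (S, W)"
proof (cases "z = c x")
  case False
  have "misleading c (S(c x \<mapsto> x)) = misleading c S"
    using assms by (auto simp: misleading_def)
  moreover have "missing c S = insert (c x) (missing c (S(c x \<mapsto> x)))" "c x \<notin> missing c (S(c x \<mapsto> x))"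
    using assms by (auto simp: missing_def split: if_splits)
  then have "card (missing c S) = card (missing c (S(c x \<mapsto> x))) + 1"
    by simp
  ultimately show ?thesis using False assms by (simp add: play_round_def)
qed (simp add: play_round_def)

text \<open>An informative mistake gains 2 either way. A genuine explanation settles the pair (3)
  and is lost (1). A misleading one yields a feature for the wrong label, but its removal gains
  2.\<close>

lemma potential_update_known_label:
  fixes c :: "'x \<Rightarrow> 'y::finite"
  assumes "S (c x) \<noteq> None" and x': "S z = Some x'"
    and feat: "\<And>a. c x' \<noteq> c x \<Longrightarrow> (c a = c x \<longrightarrow> feat t z x' a) \<and> (c a = c x' \<longrightarrow> \<not> feat t z x' a)"
  shows "2 * of_bool (z \<noteq> c x \<and> (W (c x) z x \<longrightarrow> W z (c x) x))
      + potential c (update (S, W) (play_round t x (c x) feat (z, x'))) \<le> potential c (S, W)"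
proof (cases "z \<noteq> c x \<and> (W (c x) z x \<longrightarrow> W z (c x) x)")
  case True
  define y where "y = c x"
  let ?W = "orient W y z (feat t z x')"
  let ?S = "S(z := None)"
  \<comment> \<open>Were the pair settled, \<open>y\<close> would strictly beat \<open>z\<close> on
    \<open>x\<close> itself. Hence even a useless feature cannot enlarge
    \<open>unsettled\<close>.\<close>
  have z: "z \<noteq> y" and not_settled: "\<not> settled c W y z"
    using True by (auto simp: settled_def y_def)
  have upd: "update (S, W) (play_round t x (c x) feat (z, x')) = (?S, ?W)"
    using True assms(1) x' by (auto simp: play_round_def y_def)
  have new: "unsettled c ?W \<subseteq> unsettled c W"
  proof (clarify)
    fix u v assume uv: "(u, v) \<in> unsettled c ?W"
    show "(u, v) \<in> unsettled c W"
    proof (cases "(u, v) = (y, z) \<or> (u, v) = (z, y)")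
      case True
      then show ?thesis
        using uv not_settled settled_commute[of c W y z] by (auto simp: unsettled_def)
    next
      case False
      then show ?thesis
        using uv unsettled_orient[of c W y z "feat t z x'"] by auto
    qed
  qed
  show ?thesis
  proof (cases "c x' = z")
    case good: True
    have "settled c ?W y z"
      using feat good z by (intro settled_orient) (auto simp: y_def)
    then have "(y, z) \<notin> unsettled c ?W" "(z, y) \<notin> unsettled c ?W"
      using settled_commute[of c ?W y z] by (auto simp: unsettled_def)
    then have "card (unsettled c ?W \<union> {(y, z), (z, y)}) = card (unsettled c ?W) + 2"
      using z by (subst card_Un_disjoint) auto
    moreover have "{(y, z), (z, y)} \<subseteq> unsettled c W"
      using not_settled z good by (auto simp: unsettled_def y_def settled_commute[of c W z])
    then have "card (unsettled c ?W \<union> {(y, z), (z, y)}) \<le> card (unsettled c W)"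
      using new by (intro card_mono) auto
    ultimately have "card (unsettled c ?W) + 2 \<le> card (unsettled c W)"
      by simp
    moreover have "misleading c ?S = misleading c S"
      using good x' by (auto simp: misleading_def)
    moreover have "missing c ?S = insert z (missing c S)"
      using good x' by (auto simp: missing_def split: if_splits)
    then have "card (missing c ?S) \<le> card (missing c S) + 1"
      by (simp add: card_insert_if)
    ultimately show ?thesis unfolding upd by simp
  next
    case bad: False
    have "misleading c S = insert z (misleading c ?S)" "z \<notin> misleading c ?S"
      using bad x' by (auto simp: misleading_def split: if_splits)
    then have "card (misleading c S) = card (misleading c ?S) + 1"
      by simp
    moreover have "missing c ?S = missing c S"
      using bad x' by (auto simp: missing_def)
    moreover have "card (unsettled c ?W) \<le> card (unsettled c W)"
      using new by (simp add: card_mono)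
    ultimately show ?thesis unfolding upd by simp
  qed
next
  case False
  then show ?thesis using assms(1) x' by (auto simp: play_round_def)
qed

section \<open>From one round to the expected number of mistakes\<close>

text \<open>If the true label has no explanation, the bound holds for every prediction. Otherwise it
  holds on average: the strategy makes informative mistakes at least half of all mistakes, and each
  pays 2.\<close>

lemma expected_potential_step:
  fixes c :: "'x \<Rightarrow> 'y::finite"
  assumes feat: "\<And>z x' a. c x' \<noteq> c x \<Longrightarrow>
      (c a = c x \<longrightarrow> feat t z x' a) \<and> (c a = c x' \<longrightarrow> \<not> feat t z x' a)"
  shows "measure_pmf.expectation (learner x0 y0 h x)
      (\<lambda>p. of_bool (fst p \<noteq> c x) + potential c (update (state_of x0 y0 h) (play_round t x (c x) feat p)))
    \<le> potential c (state_of x0 y0 h)"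
proof -
  obtain S W where s: "state_of x0 y0 h = (S, W)" by fastforce
  let ?V = "\<lambda>p. potential c (update (S, W) (play_round t x (c x) feat p))"
  let ?L = "learner x0 y0 h x"
  have int: "integrable (measure_pmf ?L) f" for f :: "_ \<Rightarrow> real"
    by (rule integrable_measure_pmf_finite[OF finite_set_pmf_learner])
  show ?thesis
  proof (cases "S (c x) = None")
    case True
    then have "measure_pmf.expectation ?L (\<lambda>p. of_bool (fst p \<noteq> c x) + ?V p)
        \<le> measure_pmf.expectation ?L (\<lambda>_. potential c (S, W))"
      by (intro integral_mono int) (metis potential_update_new_label prod.collapse)
    then show ?thesis by (simp add: s)
  next
    case False
    then have ne: "dom S \<noteq> {}" and y: "c x \<in> dom S" by auto
    let ?p = "strategy (dom S) (\<lambda>u v. W u v x)"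
    let ?B = "{z. z \<noteq> c x \<and> (W (c x) z x \<longrightarrow> W z (c x) x)}"
    have L: "?L = map_pmf (\<lambda>z. (z, the (S z))) ?p"
      using ne by (simp add: learner_def s)
    have int': "integrable (measure_pmf ?p) f" for f :: "_ \<Rightarrow> real"
      by (rule integrable_measure_pmf_finite) simp
    have indic: "measure_pmf.expectation ?p (\<lambda>z. of_bool (z \<in> X)) = measure_pmf.prob ?p X" for X
    proof -
      have "(\<lambda>z. of_bool (z \<in> X) :: real) = indicator X"
        by (auto simp: indicator_def)
      then show ?thesis by simp
    qed
    have "measure_pmf.expectation ?p (\<lambda>z. 2 * of_bool (z \<in> ?B) + ?V (z, the (S z)))
        \<le> measure_pmf.expectation ?p (\<lambda>_. potential c (S, W))"
    \<comment> \<open>The comparison is made on the support only, where \<open>S z\<close> is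
      defined.\<close>
    proof (intro integral_mono_AE int' AE_pmfI)
      fix z assume "z \<in> set_pmf ?p"
      then have "S z = Some (the (S z))"
        using set_pmf_strategy[OF ne] by force
      then show "2 * of_bool (z \<in> ?B) + ?V (z, the (S z)) \<le> potential c (S, W)"
        using potential_update_known_label[of S c x z "the (S z)" feat t W] False feat by simp
    qed
    then have "2 * measure_pmf.prob ?p ?B + measure_pmf.expectation ?p (\<lambda>z. ?V (z, the (S z)))
        \<le> potential c (S, W)"
      by (simp only: Bochner_Integration.integral_add[OF int' int'] integral_mult_right_zero indic) simp
    moreover have "measure_pmf.prob ?p {z. z \<noteq> c x} \<le> 2 * measure_pmf.prob ?p ?B"
      using strategy_bound[OF ne y, of "\<lambda>u v. W u v x"] .
    ultimately have "measure_pmf.expectation ?p (\<lambda>z. of_bool (z \<in> {z. z \<noteq> c x}) + ?V (z, the (S z)))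
        \<le> potential c (S, W)"
      by (simp only: Bochner_Integration.integral_add[OF int' int'] indic)
    then show ?thesis
      by (simp add: L s)
  qed
qed

lemma finite_set_pmf_dff_run:
  assumes "\<And>h x. finite (set_pmf (L (xs 0) (ys 0) h x))"
  shows "finite (set_pmf (dff_run L xs ys feat n))"
  by (induction n) (simp_all add: assms)

lemma length_dff_run:
  assumes "h \<in> set_pmf (dff_run L xs ys feat n)"
  shows "length h = n"
  using assms by (induction n arbitrary: h) auto

text \<open>A drift bound: conditioning on the history, round \<open>t\<close> raises the
  expectation of \<open>V\<close> by at most \<open>b t\<close>.\<close>

lemma dff_run_expectation_le:
  fixes V :: "('x, 'y) rnd list \<Rightarrow> real"
  assumes fin: "\<And>h x. finite (set_pmf (L (xs 0) (ys 0) h x))"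
    and step: "\<And>h t. t = Suc (length h) \<Longrightarrow>
      measure_pmf.expectation (L (xs 0) (ys 0) h (xs t))
        (\<lambda>p. V (h @ [play_round t (xs t) (ys t) feat p])) \<le> V h + b t"
  shows "measure_pmf.expectation (dff_run L xs ys feat n) V \<le> V [] + (\<Sum>t=1..n. b t)"
proof (induction n)
  case (Suc n)
  let ?D = "dff_run L xs ys feat n"
  have finD: "finite (set_pmf ?D)" by (rule finite_set_pmf_dff_run) (rule fin)
  have "measure_pmf.expectation (dff_run L xs ys feat (Suc n)) V
      = (\<Sum>h\<in>set_pmf ?D. pmf ?D h * measure_pmf.expectation (L (xs 0) (ys 0) h (xs (Suc (length h))))
          (\<lambda>p. V (h @ [play_round (Suc (length h)) (xs (Suc (length h))) (ys (Suc (length h))) feat p])))"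
    by (simp add: pmf_expectation_bind[OF finD] fin)
  also have "\<dots> \<le> (\<Sum>h\<in>set_pmf ?D. pmf ?D h * (V h + b (Suc n)))"
    \<comment> \<open>Histories in the support have length \<open>n\<close>, so the round played is
      \<open>Suc n\<close>.\<close>
    by (intro sum_mono mult_left_mono) (use step length_dff_run in \<open>force+\<close>)
  also have "\<dots> = measure_pmf.expectation ?D V + b (Suc n)"
    by (simp add: integral_measure_pmf[OF finD] distrib_left sum.distrib sum_pmf_eq_1[OF finD]
        flip: sum_distrib_right)
  also have "\<dots> \<le> V [] + (\<Sum>t=1..Suc n. b t)"
    using Suc.IH by simp
  finally show ?case .
qed simp

lemma mistakes_append_play_round:
  "mistakes (h @ [play_round t x y feat p]) = mistakes h + of_bool (fst p \<noteq> y)"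
  by (cases p) (simp add: mistakes_def play_round_def)

text \<open>Mistakes plus potential do not grow in expectation in a conforming round and grow by at
  most 5 in an exception. Round 0 has no prediction and acts only through the initial
  potential.\<close>

lemma expected_mistakes:
  fixes c :: "'x \<Rightarrow> 'y::finite"
  assumes label: "\<And>t. t \<notin> E \<Longrightarrow> ys t = c (xs t)"
    and feat: "\<And>t z x' a. 1 \<le> t \<Longrightarrow> t \<notin> E \<Longrightarrow> c x' \<noteq> c (xs t) \<Longrightarrow>
      (c a = c (xs t) \<longrightarrow> feat t z x' a) \<and> (c a = c x' \<longrightarrow> \<not> feat t z x' a)"
  shows "measure_pmf.expectation (dff_run learner xs ys feat n) (\<lambda>h. real (mistakes h))
    \<le> potential c ([ys 0 \<mapsto> xs 0], \<lambda>_ _ _. False) + 5 * card (E \<inter> {1..n})"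
proof -
  define V :: "('x, 'y) rnd list \<Rightarrow> real"
    where "V = (\<lambda>h. mistakes h + potential c (state_of (xs 0) (ys 0) h))"
  have int: "integrable (measure_pmf (dff_run learner xs ys feat n)) f" for f :: "_ \<Rightarrow> real"
    by (intro integrable_measure_pmf_finite finite_set_pmf_dff_run finite_set_pmf_learner)
  have "measure_pmf.expectation (dff_run learner xs ys feat n) (\<lambda>h. real (mistakes h))
      \<le> measure_pmf.expectation (dff_run learner xs ys feat n) V"
    by (intro integral_mono int) (simp add: V_def potential_nonneg)
  also have "\<dots> \<le> V [] + (\<Sum>t=1..n. 5 * of_bool (t \<in> E))"
  proof (rule dff_run_expectation_le[OF finite_set_pmf_learner])
    fix h :: "('x, 'y) rnd list" and t assume t: "t = Suc (length h)"
    let ?L = "learner (xs 0) (ys 0) h (xs t)"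
    let ?s = "state_of (xs 0) (ys 0) h"
    let ?v = "\<lambda>p. of_bool (fst p \<noteq> ys t) + potential c (update ?s (play_round t (xs t) (ys t) feat p))"
    have intL: "integrable (measure_pmf ?L) f" for f :: "_ \<Rightarrow> real"
      by (rule integrable_measure_pmf_finite[OF finite_set_pmf_learner])
    have "measure_pmf.expectation ?L ?v \<le> potential c ?s + 5 * of_bool (t \<in> E)"
    proof (cases "t \<in> E")
      case True
      have "measure_pmf.expectation ?L ?v \<le> measure_pmf.expectation ?L (\<lambda>_. potential c ?s + 5)"
      proof (intro integral_mono intL)
        fix p :: "'y \<times> 'x"
        show "?v p \<le> potential c ?s + 5"
          using potential_update_le[of c ?s t "xs t" "ys t" feat "fst p" "snd p"] by (simp add: of_bool_def)
      qed
      then show ?thesis using True by simp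
    next
      case False
      then show ?thesis
        using expected_potential_step[of c "xs t" feat t] feat[of t] label[of t] t by simp
    qed
    moreover have "(\<lambda>p. V (h @ [play_round t (xs t) (ys t) feat p])) = (\<lambda>p. real (mistakes h) + ?v p)"
      by (simp add: V_def mistakes_append_play_round state_of_append fun_eq_iff)
    ultimately show "measure_pmf.expectation ?L (\<lambda>p. V (h @ [play_round t (xs t) (ys t) feat p]))
        \<le> V h + 5 * of_bool (t \<in> E)"
      by (simp only: Bochner_Integration.integral_add[OF intL intL]) (simp add: V_def)
  qed
  also have "\<dots> = potential c ([ys 0 \<mapsto> xs 0], \<lambda>_ _ _. False) + 5 * card (E \<inter> {1..n})"
    by (simp add: V_def mistakes_def state_of_def Int_commute flip: sum_distrib_left)
  finally show ?thesis .
qed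

section \<open>The initial potential and the final bound\<close>

lemma initial_potential:
  fixes c :: "'x \<Rightarrow> 'y::finite"
  assumes "card (range c) \<le> m"
  shows "potential c ([y \<mapsto> x], W) \<le> 2 * m * (m - 1) + 3 * of_bool (y \<noteq> c x)"
proof -
  define r where "r = card (range c)"
  have "r \<ge> 1" by (simp add: r_def Suc_le_eq card_gt_0_iff)
  have "unsettled c W \<subseteq> range c \<times> range c - (\<lambda>u. (u, u)) ` range c"
    by (auto simp: unsettled_def)
  then have "card (unsettled c W) \<le> card (range c \<times> range c - (\<lambda>u. (u, u)) ` range c)"
    by (rule card_mono[rotated]) simp
  also have "\<dots> = r * r - r"
    by (subst card_Diff_subset) (auto simp: r_def card_image inj_on_def)
  finally have u: "card (unsettled c W) \<le> r * (r - 1)"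
    by (simp add: algebra_simps)
  have "misleading c [y \<mapsto> x] \<subseteq> (if y \<noteq> c x then {y} else {})"
    by (auto simp: misleading_def split: if_splits)
  then have l: "card (misleading c [y \<mapsto> x]) \<le> of_bool (y \<noteq> c x)"
    by (cases "y = c x") (auto dest: card_mono[rotated])
  have "missing c [y \<mapsto> x] \<subseteq> (if y = c x then range c - {c x} else range c)"
    by (auto simp: missing_def split: if_splits)
  then have "card (missing c [y \<mapsto> x]) \<le> card (if y = c x then range c - {c x} else range c)"
    by (rule card_mono[rotated]) simp
  also have "\<dots> \<le> r - 1 + of_bool (y \<noteq> c x)"
    by (auto simp: r_def)
  finally have g: "card (missing c [y \<mapsto> x]) \<le> r - 1 + of_bool (y \<noteq> c x)" .
  define d where "d = r - 1"
  define P Q where "P = r * d" and "Q = m * (m - 1)"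
  \<comment> \<open>This absorbs the \<open>r - 1\<close> missing labels into the slack between 3/2
    and 2 times \<open>r * (r - 1)\<close>; for \<open>r = 1\<close> both sides vanish.\<close>
  have "2 * d \<le> P"
    by (cases "r = 1") (use \<open>r \<ge> 1\<close> in \<open>auto simp: P_def d_def\<close>)
  moreover have "P \<le> Q"
    unfolding P_def Q_def d_def using assms by (intro mult_mono) (auto simp: r_def)
  ultimately have "3 * card (unsettled c W) + 4 * card (misleading c [y \<mapsto> x])
      + 2 * card (missing c [y \<mapsto> x]) \<le> 2 * (2 * Q + 3 * of_bool (y \<noteq> c x))"
    using u l g unfolding d_def[symmetric] P_def[symmetric]
    by (cases "y = c x") simp_all
  then have "real (3 * card (unsettled c W) + 4 * card (misleading c [y \<mapsto> x])
      + 2 * card (missing c [y \<mapsto> x])) \<le> real (2 * (2 * Q + 3 * of_bool (y \<noteq> c x)))"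
    by (rule of_nat_mono)
  then show ?thesis by (simp add: Q_def)
qed

theorem theorem3:
  "\<exists>L :: ('x, 'y :: finite) learner. valid_learner L \<and>
     (\<forall>(Phi :: ('x \<Rightarrow> bool) set) m k Gc lab gx phi xs ys feat E n.
        (\<forall>f\<in>Phi. (\<lambda>x. \<not> f x) \<in> Phi) \<longrightarrow>
        dff_representation Phi m Gc lab gx phi \<longrightarrow>
        inj_on lab {..<m} \<longrightarrow>
        finite E \<longrightarrow> card E \<le> k \<longrightarrow>
        (\<forall>t. t \<notin> E \<longrightarrow> ys t = lab (gx (xs t))) \<longrightarrow>
        (\<forall>t. t \<ge> 1 \<longrightarrow> t \<notin> E \<longrightarrow> (\<forall>yh xh. feat t yh xh = phi (gx (xs t)) (gx xh))) \<longrightarrow>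
        measure_pmf.expectation (dff_run L xs ys feat n) (\<lambda>h. real (mistakes h))
          \<le> real (2 * m * (m - 1) + 6 * k))"
proof (intro exI[of _ learner] conjI valid_learner allI impI)
  fix Phi :: "('x \<Rightarrow> bool) set" and m k Gc and lab :: "nat \<Rightarrow> 'y" and gx phi E
    and xs :: "nat \<Rightarrow> 'x" and ys
    and feat :: "nat \<Rightarrow> 'y \<Rightarrow> 'x \<Rightarrow> 'x \<Rightarrow> bool" and n :: nat
  assume rep: "dff_representation Phi m Gc lab gx phi" and inj: "inj_on lab {..<m}"
    and E: "finite E" "card E \<le> k"
    and label: "\<forall>t. t \<notin> E \<longrightarrow> ys t = lab (gx (xs t))"
    and feat: "\<forall>t. t \<ge> 1 \<longrightarrow> t \<notin> E \<longrightarrow> (\<forall>yh xh. feat t yh xh = phi (gx (xs t)) (gx xh))"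
  define c where "c = (\<lambda>x. lab (gx x))"
  have gx: "gx x < m" "x \<in> Gc (gx x)" for x
    using rep by (auto simp: dff_representation_def)
  \<comment> \<open>Unique labels make the classes of \<open>c\<close> those of \<open>gx\<close>,
    so a feature for two components separates all examples of their labels.\<close>
  have c_eq: "c a = c b \<longleftrightarrow> gx a = gx b" for a b
    using inj gx by (auto simp: c_def inj_on_def)
  have discriminative: "(\<forall>x\<in>Gc i. phi i j x) \<and> (\<forall>x\<in>Gc j. \<not> phi i j x)"
    if "i < m" "j < m" "lab i \<noteq> lab j" for i j
    using rep that unfolding dff_representation_def by blast
  have "range c \<subseteq> lab ` {..<m}"
    using gx by (auto simp: c_def)
  then have "card (range c) \<le> m"
    using card_mono[of "lab ` {..<m}" "range c"] by (simp add: card_image inj)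
  have "(c a = c (xs t) \<longrightarrow> feat t z x' a) \<and> (c a = c x' \<longrightarrow> \<not> feat t z x' a)"
    if "1 \<le> t" "t \<notin> E" "c x' \<noteq> c (xs t)" for t z x' a
  proof -
    have "lab (gx (xs t)) \<noteq> lab (gx x')"
      using that(3) by (simp add: c_def)
    then have "phi (gx (xs t)) (gx x') b" if "b \<in> Gc (gx (xs t))" for b
      using discriminative gx(1) that by blast
    moreover have "\<not> phi (gx (xs t)) (gx x') b" if "b \<in> Gc (gx x')" for b
      using discriminative gx(1) that \<open>lab (gx (xs t)) \<noteq> lab (gx x')\<close> by blast
    moreover have "feat t z x' = phi (gx (xs t)) (gx x')"
      using feat that(1,2) by simp
    ultimately show ?thesis
      unfolding c_eq using gx(2)[of a] by metis
  qed
  then have "measure_pmf.expectation (dff_run learner xs ys feat n) (\<lambda>h. real (mistakes h))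
      \<le> potential c ([ys 0 \<mapsto> xs 0], \<lambda>_ _ _. False) + 5 * card (E \<inter> {1..n})"
    using label by (intro expected_mistakes) (auto simp: c_def)
  also have "\<dots> \<le> 2 * m * (m - 1) + 3 * of_bool (0 \<in> E) + 5 * card (E \<inter> {1..n})"
    using initial_potential[OF \<open>card (range c) \<le> m\<close>, of "ys 0" "xs 0" "\<lambda>_ _ _. False"] label
    by (cases "0 \<in> E") (auto simp: c_def of_bool_def split: if_splits)
  also have "\<dots> \<le> 2 * m * (m - 1) + 6 * k"
  proof -
    \<comment> \<open>An exception costs 3 in round 0 and 5 later, so 6 each suffices once the two
      disjoint groups are counted within \<open>E\<close>.\<close>
    have "of_bool (0 \<in> E) + card (E \<inter> {1..n}) = card ({0} \<inter> E \<union> E \<inter> {1..n})"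
      by (cases "0 \<in> E") auto
    also have "\<dots> \<le> card E"
      using E by (intro card_mono) auto
    finally have "3 * of_bool (0 \<in> E) + 5 * card (E \<inter> {1..n}) \<le> 6 * k"
      using E by linarith
    then have "real (3 * of_bool (0 \<in> E) + 5 * card (E \<inter> {1..n})) \<le> real (6 * k)"
      by (rule of_nat_mono)
    then show ?thesis by simp
  qed
  finally show "measure_pmf.expectation (dff_run learner xs ys feat n) (\<lambda>h. real (mistakes h))
      \<le> real (2 * m * (m - 1) + 6 * k)"
    by simp
qed

end
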